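(* Let $\mathcal R$ be a ring (with $1$, not necessarily commutative). (1) Strong shift equivalence over $\mathcal R$ is the equivalence relation on square matrices over $\mathcal R$ (of all finite sizes) generated by: (a) similarity over $\mathcal R$, and (b) zero extensions. (2) Shift equivalence over $\mathcal R$ is the equivalence relation on square matrices over $\mathcal R$ generated by: (a) similarity over $\mathcal R$, and (b) nilpotent extensions.
   Context: All matrices are finite matrices with entries in $\mathcal R$. Square matrices $A,B$ are elementary strong shift equivalent over $\mathcal R$ if there are (possibly rectangular) matrices $R,S$ over $\mathcal R$ with $A=RS$, $B=SR$. Strong shift equivalence over $\mathcal R$ is the transitive closure of this relation. $A,B$ are shift equivalent over $\mathcal R$ if there are matrices $R,S$ over $\mathcal R$ and a positive integer $\ell$ with $A^{\ell}=RS$, $B^{\ell}=SR$, $AR=RB$, $SA=BS$. Similarity over $\mathcal R$: $B=U^{-1}AU$ for some matrix $U$ invertible over $\mathcal R$. $B$ is a zero extension of $A$ if for some matrix $C$ over $\mathcal R$, $B=\begin{pmatrix}A&C\\0&0\end{pmatrix}$ or $B=\begin{pmatrix}A&0\\C&0\end{pmatrix}$ (block form with square diagonal blocks). $B$ is a nilpotent extension of $A$ if for some matrix $C$ and some nilpotent square matrix $N$ over $\mathcal R$, $B=\begin{pmatrix}A&C\\0&N\end{pmatrix}$ or $B=\begin{pmatrix}A&0\\C&N\end{pmatrix}$. *)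

theory Defs
  imports "Jordan_Normal_Form.Matrix" "HOL.Hull"
begin

text \<open>
  The sort \<open>{ring, monoid_mult}\<close> is that of all rings with 1, not necessarily commutative.
  It is used instead of \<open>ring_1\<close>, which in addition requires \<open>0 \<noteq> 1\<close> and so excludes the zero
  ring. The library constants \<open>pow_mat\<close> and \<open>similar_mat\<close> need \<open>0 \<noteq> 1\<close>; their counterparts
  below agree with them over \<open>ring_1\<close>. As in the library, empty matrices are admitted.
\<close>

primrec mat_power :: "'a::{ring,monoid_mult} mat \<Rightarrow> nat \<Rightarrow> 'a mat" where
  "mat_power A 0 = 1\<^sub>m (dim_row A)"
| "mat_power A (Suc k) = mat_power A k * A"

lemma mat_power_eq_pow_mat: "mat_power (A :: 'a::ring_1 mat) k = A ^\<^sub>m k"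
  by (induction k) auto

definition nilpotent_mat :: "'a::{ring,monoid_mult} mat \<Rightarrow> bool" where
  "nilpotent_mat N \<longleftrightarrow>
     square_mat N \<and> (\<exists>k. mat_power N k = 0\<^sub>m (dim_row N) (dim_row N))"

definition square_mats :: "'a mat set" where
  "square_mats = {A. square_mat A}"

definition elementary_strong_shift_equivalence :: "'a::{ring,monoid_mult} mat rel" where
  "elementary_strong_shift_equivalence =
     {(A, B). \<exists>m n R S. R \<in> carrier_mat m n \<and> S \<in> carrier_mat n m \<and> A = R * S \<and> B = S * R}"

definition strong_shift_equivalence :: "'a::{ring,monoid_mult} mat rel" where
  "strong_shift_equivalence = elementary_strong_shift_equivalence\<^sup>+"

definition shift_equivalence :: "'a::{ring,monoid_mult} mat rel" where
  "shift_equivalence =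
     {(A, B). \<exists>m n R S l. A \<in> carrier_mat m m \<and> B \<in> carrier_mat n n \<and>
        R \<in> carrier_mat m n \<and> S \<in> carrier_mat n m \<and> 0 < l \<and>
        mat_power A l = R * S \<and> mat_power B l = S * R \<and> A * R = R * B \<and> S * A = B * S}"

text \<open>In the following definition, \<open>V\<close> is the inverse of \<open>U\<close>.\<close>

definition mat_similarity :: "'a::{ring,monoid_mult} mat rel" where
  "mat_similarity =
     {(A, B). \<exists>n U V. A \<in> carrier_mat n n \<and> U \<in> carrier_mat n n \<and> V \<in> carrier_mat n n \<and>
        U * V = 1\<^sub>m n \<and> V * U = 1\<^sub>m n \<and> B = V * A * U}"

lemma mat_similarity_iff_similar_mat:
  "(A, B) \<in> mat_similarity \<longleftrightarrow> similar_mat B (A :: 'a::ring_1 mat)"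
proof
  assume "(A, B) \<in> mat_similarity"
  then obtain n U V where "A \<in> carrier_mat n n" "U \<in> carrier_mat n n" "V \<in> carrier_mat n n"
    "U * V = 1\<^sub>m n" "V * U = 1\<^sub>m n" "B = V * A * U"
    unfolding mat_similarity_def by blast
  then have "similar_mat_wit B A V U"
    unfolding similar_mat_wit_def Let_def by auto
  then show "similar_mat B A"
    unfolding similar_mat_def by blast
next
  assume "similar_mat B A"
  then show "(A, B) \<in> mat_similarity"
    unfolding similar_mat_def similar_mat_wit_def mat_similarity_def Let_def by blast
qed

text \<open>A pair \<open>(A, B)\<close> in one of the next two relations means that \<open>B\<close> is an extension of \<open>A\<close>.\<close>

definition zero_extension :: "'a::{ring,monoid_mult} mat rel" where
  "zero_extension =
     {(A, B). \<exists>n k C. A \<in> carrier_mat n n \<and>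
        (C \<in> carrier_mat n k \<and> B = four_block_mat A C (0\<^sub>m k n) (0\<^sub>m k k) \<or>
         C \<in> carrier_mat k n \<and> B = four_block_mat A (0\<^sub>m n k) C (0\<^sub>m k k))}"

definition nilpotent_extension :: "'a::{ring,monoid_mult} mat rel" where
  "nilpotent_extension =
     {(A, B). \<exists>n k C N. A \<in> carrier_mat n n \<and> N \<in> carrier_mat k k \<and> nilpotent_mat N \<and>
        (C \<in> carrier_mat n k \<and> B = four_block_mat A C (0\<^sub>m k n) N \<or>
         C \<in> carrier_mat k n \<and> B = four_block_mat A (0\<^sub>m n k) C N)}"

text \<open>The least equivalence relation on \<open>X\<close> containing \<open>r \<subseteq> X \<times> X\<close>.\<close>

definition generated_equiv :: "'b set \<Rightarrow> 'b rel \<Rightarrow> 'b rel" where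
  "generated_equiv X r = equiv X hull r"

lemma generated_equiv_is_equiv:
  assumes "r \<subseteq> X \<times> X"
  shows "equiv X (generated_equiv X r)"
proof (rule equivI)
  have all: "equiv X (X \<times> X)"
    by (auto simp: equiv_def refl_on_def sym_def trans_def)
  show "generated_equiv X r \<subseteq> X \<times> X"
    using all assms unfolding generated_equiv_def hull_def by blast
  show "refl_on X (generated_equiv X r)"
    unfolding generated_equiv_def hull_def by (auto simp: refl_on_def equiv_def)
  show "sym (generated_equiv X r)"
    unfolding generated_equiv_def hull_def by (auto intro!: symI dest: equivE symD simp: equiv_def)
  show "trans (generated_equiv X r)"
    unfolding generated_equiv_def hull_def
    by (rule transI) (auto simp: equiv_def intro: transD)
qed

lemma relations_on_square_mats:
  "mat_similarity \<subseteq> square_mats \<times> square_mats"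
  "zero_extension \<subseteq> square_mats \<times> square_mats"
  "nilpotent_extension \<subseteq> square_mats \<times> square_mats"
  by (auto simp: mat_similarity_def zero_extension_def nilpotent_extension_def square_mats_def)

end

theory Submission
  imports Defs
begin

text \<open>
  Conjugating the zero extension \<open>(RS, 0; S, 0)\<close> of \<open>RS\<close> by \<open>(1, R; 0, 1)\<close> gives \<open>(0, 0; S, SR)\<close>,
  which is a zero extension of \<open>SR\<close> up to the order of the blocks. If only \<open>AR = RB\<close> and \<open>SR = B\<close>,
  then the same conjugation turns \<open>(A, 0; S, 0)\<close> into \<open>(A - RS, 0; S, B)\<close>, and \<open>A - RS\<close> is nilpotent
  as soon as some power of \<open>A\<close> factors through \<open>R\<close> on the left, because
  \<open>(A - RS)\<^sup>2 = (A - RS)A\<close> and \<open>(A - RS)R = 0\<close>. A shift equivalence of lag \<open>l\<close> has \<open>SR = B\<^sup>l\<close>; the exponent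
  drops by one when \<open>A\<close> is replaced by its zero extension \<open>(A, 0; S, 0)\<close>, the column
  \<open>R\<close> by \<open>(R; B\<^sup>l\<^sup>-\<^sup>1)\<close> and the row \<open>S\<close> by \<open>(0, 1)\<close>.
\<close>

section \<open>Matrices over a possibly trivial ring\<close>

text \<open>The library states the next two facts for \<open>semiring_1\<close> only, which excludes the zero ring.\<close>

lemma left_mult_one [simp]:
  fixes A :: "'a::{ring,monoid_mult} mat"
  assumes "dim_row A = n"
  shows "1\<^sub>m n * A = A"
  using assms
  by (intro eq_matI)
    (auto simp: scalar_prod_def if_distrib[where f = "\<lambda>x. x * y" for y] cong: if_cong)

lemma right_mult_one [simp]:
  fixes A :: "'a::{ring,monoid_mult} mat"
  assumes "dim_col A = n"
  shows "A * 1\<^sub>m n = A"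
  using assms
  by (intro eq_matI)
    (auto simp: scalar_prod_def if_distrib[where f = "\<lambda>x. y * x" for y] cong: if_cong)

lemma mat_power_carrier [simp]:
  "A \<in> carrier_mat n n \<Longrightarrow> mat_power A k \<in> carrier_mat n n"
  by (induction k) auto

lemma mat_power_dim [simp]:
  "A \<in> carrier_mat n n \<Longrightarrow> dim_row (mat_power A k) = n"
  "A \<in> carrier_mat n n \<Longrightarrow> dim_col (mat_power A k) = n"
  using mat_power_carrier by blast+

lemma mat_power_Suc_left:
  assumes A: "A \<in> carrier_mat n n"
  shows "mat_power A (Suc k) = A * mat_power A k"
proof (induction k)
  case (Suc k)
  have "mat_power A (Suc (Suc k)) = (A * mat_power A k) * A"
    using Suc by simp
  also have "\<dots> = A * mat_power A (Suc k)"
    using assoc_mult_mat[OF A mat_power_carrier[OF A] A] by simp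
  finally show ?case .
qed (use A in auto)

lemma mat_power_add:
  assumes A: "A \<in> carrier_mat n n"
  shows "mat_power A (k + l) = mat_power A k * mat_power A l"
proof (induction l)
  case (Suc l)
  then show ?case
    using assoc_mult_mat[OF mat_power_carrier[OF A] mat_power_carrier[OF A] A] by simp
qed (use A in auto)

lemma mat_power_intertwine:
  assumes A: "A \<in> carrier_mat m m" and B: "B \<in> carrier_mat n n" and R: "R \<in> carrier_mat m n"
    and AR: "A * R = R * B"
  shows "mat_power A k * R = R * mat_power B k"
proof (induction k)
  case (Suc k)
  note [simp] = mat_power_carrier[OF A] mat_power_carrier[OF B]
  have "mat_power A (Suc k) * R = mat_power A k * (R * B)"
    using assoc_mult_mat[OF mat_power_carrier[OF A] A R] AR by simp
  also have "\<dots> = (mat_power A k * R) * B"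
    using assoc_mult_mat[OF mat_power_carrier[OF A] R B] by simp
  also have "\<dots> = R * mat_power B (Suc k)"
    using assoc_mult_mat[OF R mat_power_carrier[OF B] B] Suc by simp
  finally show ?case .
qed (use A B R in auto)

section \<open>Block rows and columns\<close>

text \<open>The mirror image of \<open>append_rows\<close>: empty lower blocks make every product of
  rows and columns an instance of \<open>mult_four_block_mat\<close>.\<close>

definition append_cols :: "'a::zero mat \<Rightarrow> 'a mat \<Rightarrow> 'a mat" (infixr \<open>@\<^sub>c\<close> 65) where
  "A @\<^sub>c B = four_block_mat A B (0\<^sub>m 0 (dim_col A)) (0\<^sub>m 0 (dim_col B))"

lemma append_cols_carrier [simp, intro]:
  "A \<in> carrier_mat n m \<Longrightarrow> B \<in> carrier_mat n k \<Longrightarrow> A @\<^sub>c B \<in> carrier_mat n (m + k)"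
  unfolding append_cols_def by auto

lemma append_cols_mult_append_rows:
  fixes A :: "'a::ring mat"
  assumes c: "A \<in> carrier_mat m n" "B \<in> carrier_mat m k" "C \<in> carrier_mat n p" "D \<in> carrier_mat k p"
  shows "(A @\<^sub>c B) * (C @\<^sub>r D) = A * C + B * D"
proof -
  have "(A @\<^sub>c B) * (C @\<^sub>r D) =
    four_block_mat (A * C + B * D) (0\<^sub>m m 0) (0\<^sub>m 0 p) (0\<^sub>m 0 0)"
    unfolding append_cols_def append_rows_def
    using c by (subst mult_four_block_mat[of _ m n _ k _ 0 _ _ p _ 0]) auto
  also have "\<dots> = A * C + B * D"
    using c by (intro eq_matI) auto
  finally show ?thesis .
qed

lemma append_rows_mult_append_cols:
  fixes A :: "'a::ring mat"
  assumes c: "A \<in> carrier_mat m n" "B \<in> carrier_mat k n" "C \<in> carrier_mat n p" "D \<in> carrier_mat n q"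
  shows "(A @\<^sub>r B) * (C @\<^sub>c D) = four_block_mat (A * C) (A * D) (B * C) (B * D)"
  unfolding append_cols_def append_rows_def
  using c by (subst mult_four_block_mat[of _ m n _ 0 _ k _ _ p _ q]) auto

lemma append_rows_mult:
  fixes A :: "'a::ring mat"
  assumes c: "A \<in> carrier_mat m n" "B \<in> carrier_mat k n" "C \<in> carrier_mat n p"
  shows "(A @\<^sub>r B) * C = (A * C) @\<^sub>r (B * C)"
proof -
  \<comment> \<open>Padding with empty blocks gives \<open>C\<close> the shape that block
    multiplication expects.\<close>
  have "C = four_block_mat C (0\<^sub>m n 0) (0\<^sub>m 0 p) (0\<^sub>m 0 0)"
    using c by (intro eq_matI) auto
  then have "(A @\<^sub>r B) * C = (A @\<^sub>r B) * four_block_mat C (0\<^sub>m n 0) (0\<^sub>m 0 p) (0\<^sub>m 0 0)"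
    by simp
  also have "\<dots> = (A * C) @\<^sub>r (B * C)"
    unfolding append_rows_def
    using c by (subst mult_four_block_mat[of _ m n _ 0 _ k _ _ p _ 0]) auto
  finally show ?thesis .
qed

lemma mult_append_cols:
  fixes A :: "'a::ring mat"
  assumes c: "A \<in> carrier_mat m n" "B \<in> carrier_mat n p" "C \<in> carrier_mat n q"
  shows "A * (B @\<^sub>c C) = (A * B) @\<^sub>c (A * C)"
proof -
  have "A = four_block_mat A (0\<^sub>m m 0) (0\<^sub>m 0 n) (0\<^sub>m 0 0)"
    using c by (intro eq_matI) auto
  then have "A * (B @\<^sub>c C) = four_block_mat A (0\<^sub>m m 0) (0\<^sub>m 0 n) (0\<^sub>m 0 0) * (B @\<^sub>c C)"
    by simp
  also have "\<dots> = (A * B) @\<^sub>c (A * C)"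
    unfolding append_cols_def
    using c by (subst mult_four_block_mat[of _ m n _ 0 _ 0 _ _ p _ q]) auto
  finally show ?thesis .
qed

lemma four_block_mult_append_rows:
  fixes A :: "'a::ring mat"
  assumes c: "A \<in> carrier_mat m n" "B \<in> carrier_mat m k" "C \<in> carrier_mat p n" "D \<in> carrier_mat p k"
    "E \<in> carrier_mat n q" "F \<in> carrier_mat k q"
  shows "four_block_mat A B C D * (E @\<^sub>r F) = (A * E + B * F) @\<^sub>r (C * E + D * F)"
  unfolding append_rows_def
  using c by (subst mult_four_block_mat[of _ m n _ k _ p _ _ q _ 0]) auto

lemma append_cols_mult_four_block:
  fixes A :: "'a::ring mat"
  assumes c: "A \<in> carrier_mat m n" "B \<in> carrier_mat m k" "C \<in> carrier_mat n p" "D \<in> carrier_mat n q"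
    "E \<in> carrier_mat k p" "F \<in> carrier_mat k q"
  shows "(A @\<^sub>c B) * four_block_mat C D E F = (A * C + B * E) @\<^sub>c (A * D + B * F)"
  unfolding append_cols_def
  using c by (subst mult_four_block_mat[of _ m n _ k _ 0 _ _ p _ q]) auto

section \<open>Equivalence relations generated by a relation\<close>

text \<open>Minimality of the hull settles one inclusion, so only the pairs of \<open>E\<close>
  remain to be derived from \<open>r\<close>.\<close>

lemma generated_equiv_eqI:
  assumes r: "r \<subseteq> E" and E: "equiv X E"
    and le: "\<And>a b. (a, b) \<in> E \<Longrightarrow> (a, b) \<in> generated_equiv X r"
  shows "E = generated_equiv X r"
proof
  show "generated_equiv X r \<subseteq> E"
    unfolding generated_equiv_def by (rule hull_minimal) (rule r E)+
qed (use le in auto)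

lemma generated_equiv_incl: "(a, b) \<in> r \<Longrightarrow> (a, b) \<in> generated_equiv X r"
  unfolding generated_equiv_def by (rule hull_inc)

text \<open>The pattern of both constructions below: extend \<open>a\<close>, apply two
  similarities, and recognise the result \<open>d\<close> as an extension of \<open>e\<close>. The
  last pair is therefore traversed backwards.\<close>

lemma equiv_zigzag:
  assumes "equiv X E" and "(a, b) \<in> E" "(b, c) \<in> E" "(c, d) \<in> E" "(e, d) \<in> E"
  shows "(a, e) \<in> E"
proof -
  have "sym E" "trans E"
    using assms(1) unfolding equiv_def by blast+
  with assms(2-) show ?thesis
    by (metis symE transE)
qed

lemma zero_extension_nilpotent: "zero_extension \<subseteq> nilpotent_extension"
proof -
  \<comment> \<open>The exponent 1 serves every size; the zeroth power would be the
    identity.\<close>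
  have "nilpotent_mat (0\<^sub>m k k :: 'a mat)" for k
    unfolding nilpotent_mat_def by (auto intro!: exI[of _ "Suc 0"])
  then show ?thesis
    unfolding zero_extension_def nilpotent_extension_def
    by clarsimp (metis zero_carrier_mat)
qed

section \<open>Similarities between block matrices\<close>

lemma mat_similarityI:
  assumes "A \<in> carrier_mat n n" "U \<in> carrier_mat n n" "V \<in> carrier_mat n n"
    and "U * V = 1\<^sub>m n" "V * U = 1\<^sub>m n" "V * A * U = B"
  shows "(A, B) \<in> mat_similarity"
  unfolding mat_similarity_def assms(6)[symmetric]
  using assms(1-5) by blast

text \<open>Conjugation by a block permutation matrix. It moves a matrix from the lower right corner
  to the upper left one, where the definitions of the extensions want it.\<close>

lemma mat_similarity_swap_blocks:
  fixes A :: "'a::{ring,monoid_mult} mat"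
  assumes c: "A \<in> carrier_mat n n" "B \<in> carrier_mat n k" "C \<in> carrier_mat k n" "D \<in> carrier_mat k k"
  shows "(four_block_mat A B C D, four_block_mat D C B A) \<in> mat_similarity"
proof -
  define U :: "'a mat" where "U = four_block_mat (0\<^sub>m n k) (1\<^sub>m n) (1\<^sub>m k) (0\<^sub>m k n)"
  define V :: "'a mat" where "V = four_block_mat (0\<^sub>m k n) (1\<^sub>m k) (1\<^sub>m n) (0\<^sub>m n k)"
  \<comment> \<open>The blocks split rows and columns in opposite orders, so \<open>U\<close> and
    \<open>V\<close> are seen to be square only after commuting the sum.\<close>
  have "U \<in> carrier_mat (n + k) (k + n)" "V \<in> carrier_mat (k + n) (n + k)"
    unfolding U_def V_def by (rule four_block_carrier_mat; simp)+
  then have UV: "U \<in> carrier_mat (n + k) (n + k)" "V \<in> carrier_mat (n + k) (n + k)"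
    by (simp_all add: add.commute)
  have "U * V = 1\<^sub>m (n + k)"
    unfolding U_def V_def by (subst mult_four_block_mat[of _ n k _ n _ k _ _ n _ k]) auto
  moreover have "V * U = 1\<^sub>m (n + k)"
    unfolding U_def V_def
    by (subst mult_four_block_mat[of _ k n _ k _ n _ _ k _ n]) (auto simp: add.commute)
  moreover have "V * four_block_mat A B C D * U = four_block_mat D C B A"
    unfolding U_def V_def using c
    by (simp add: mult_four_block_mat[of _ k n _ k _ n _ _ n _ k]
        mult_four_block_mat[of _ k n _ k _ n _ _ k _ n])
  ultimately show ?thesis
    by (rule mat_similarityI[OF four_block_carrier_mat[OF c(1,4)] UV])
qed

text \<open>Multiplying by \<open>V\<close> on the left subtracts \<open>R\<close> times the lower
  block row from the upper one; multiplying by \<open>U\<close> on the right adds the left block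
  column times \<open>R\<close> to the right one.\<close>

lemma mat_similarity_shear:
  fixes A :: "'a::{ring,monoid_mult} mat"
  assumes A: "A \<in> carrier_mat n n" and B: "B \<in> carrier_mat k k"
    and R: "R \<in> carrier_mat n k" and S: "S \<in> carrier_mat k n"
    and AR: "A * R = R * B" and SR: "S * R = B"
  shows "(four_block_mat A (0\<^sub>m n k) S (0\<^sub>m k k), four_block_mat (A - R * S) (0\<^sub>m n k) S B) \<in> mat_similarity"
proof -
  define U where "U = four_block_mat (1\<^sub>m n) R (0\<^sub>m k n) (1\<^sub>m k)"
  define V where "V = four_block_mat (1\<^sub>m n) (- R) (0\<^sub>m k n) (1\<^sub>m k)"
  have [simp]: "- 0\<^sub>m k k = (0\<^sub>m k k :: 'a mat)"
    by (intro eq_matI) auto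
  have [simp]: "R + - R = 0\<^sub>m n k"
    using R by (intro eq_matI) auto
  have UV: "U \<in> carrier_mat (n + k) (n + k)" "V \<in> carrier_mat (n + k) (n + k)"
    unfolding U_def V_def by (rule four_block_carrier_mat; simp)+
  have M: "four_block_mat A (0\<^sub>m n k) S (0\<^sub>m k k) \<in> carrier_mat (n + k) (n + k)"
    using A by (rule four_block_carrier_mat) simp
  have "U * V = 1\<^sub>m (n + k)"
    unfolding U_def V_def using R
    by (subst mult_four_block_mat[of _ n n _ k _ k _ _ n _ k]) auto
  moreover have "V * U = 1\<^sub>m (n + k)"
    unfolding U_def V_def using R
    by (subst mult_four_block_mat[of _ n n _ k _ k _ _ n _ k]) auto
  moreover have "V * four_block_mat A (0\<^sub>m n k) S (0\<^sub>m k k) * U = four_block_mat (A - R * S) (0\<^sub>m n k) S B"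
  proof -
    have RS: "R * S \<in> carrier_mat n n" and RB: "R * B \<in> carrier_mat n k"
      using R S B by auto
    have 1: "A + - R * S = A - R * S"
      using A R S RS by (auto simp: minus_add_uminus_mat[OF A RS])
    \<comment> \<open>Both \<open>A * R\<close> and \<open>R * (S * R)\<close> equal
      \<open>R * B\<close>.\<close>
    have 2: "(A - R * S) * R = 0\<^sub>m n k"
      using minus_mult_distrib_mat[OF A RS R] assoc_mult_mat[OF R S R] RB AR SR
      by simp
    have "V * four_block_mat A (0\<^sub>m n k) S (0\<^sub>m k k) = four_block_mat (A - R * S) (0\<^sub>m n k) S (0\<^sub>m k k)"
      unfolding V_def using A R S
      by (subst mult_four_block_mat[of _ n n _ k _ k _ _ n _ k]) (auto simp: 1)
    also have "\<dots> * U = four_block_mat (A - R * S) (0\<^sub>m n k) S B"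
      unfolding U_def using A R S RS B
      by (subst mult_four_block_mat[of _ n n _ k _ k _ _ n _ k]) (auto simp: 2 SR)
    finally show ?thesis .
  qed
  ultimately show ?thesis
    by (rule mat_similarityI[OF M UV])
qed

section \<open>Strong shift equivalence\<close>

lemma elementary_sse_square: "elementary_strong_shift_equivalence \<subseteq> square_mats \<times> square_mats"
  unfolding elementary_strong_shift_equivalence_def square_mats_def by auto

lemma elementary_sseI:
  "R \<in> carrier_mat m n \<Longrightarrow> S \<in> carrier_mat n m \<Longrightarrow>
    (R * S, S * R) \<in> elementary_strong_shift_equivalence"
  unfolding elementary_strong_shift_equivalence_def by blast

lemma equiv_sse: "equiv square_mats (strong_shift_equivalence :: 'a::{ring,monoid_mult} mat rel)"
proof (rule equivI)
  show "strong_shift_equivalence \<subseteq> (square_mats \<times> square_mats :: 'a mat rel)"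
    unfolding strong_shift_equivalence_def by (rule trancl_subset_Sigma[OF elementary_sse_square])
  show "refl_on square_mats (strong_shift_equivalence :: 'a mat rel)"
  proof (rule refl_onI)
    fix A :: "'a mat" assume "A \<in> square_mats"
    then obtain n where A: "A \<in> carrier_mat n n"
      unfolding square_mats_def by auto
    \<comment> \<open>The factors are \<open>A\<close> and the identity.\<close>
    then have "(A, A) \<in> elementary_strong_shift_equivalence"
      using elementary_sseI[OF A one_carrier_mat] by simp
    then show "(A, A) \<in> strong_shift_equivalence"
      unfolding strong_shift_equivalence_def by (rule r_into_trancl)
  qed
  have "sym (elementary_strong_shift_equivalence :: 'a mat rel)"
    unfolding elementary_strong_shift_equivalence_def sym_def by blast
  then show "sym (strong_shift_equivalence :: 'a mat rel)"
    unfolding strong_shift_equivalence_def by (rule sym_trancl)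
  show "trans (strong_shift_equivalence :: 'a mat rel)"
    unfolding strong_shift_equivalence_def by (rule trans_trancl)
qed

text \<open>The two factors are \<open>U\<close> and \<open>V * A\<close>.\<close>

lemma mat_similarity_elementary_sse: "mat_similarity \<subseteq> elementary_strong_shift_equivalence"
proof (rule subrelI)
  fix A B :: "'a mat"
  assume "(A, B) \<in> mat_similarity"
  then obtain n U V where c: "A \<in> carrier_mat n n" "U \<in> carrier_mat n n" "V \<in> carrier_mat n n"
    and UV: "U * V = 1\<^sub>m n" and B: "B = V * A * U"
    unfolding mat_similarity_def by blast
  have "A = U * (V * A)"
    using assoc_mult_mat[OF c(2,3,1)] UV c by simp
  then show "(A, B) \<in> elementary_strong_shift_equivalence"
    using elementary_sseI[OF c(2) mult_carrier_mat[OF c(3,1)]] B by simp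
qed

text \<open>The block row (or column) of the extension that contains \<open>A\<close> is one factor,
  the inclusion (or projection) of the first \<open>n\<close> coordinates the other. One order of
  multiplication leaves \<open>A\<close>, the other fills up with zeros.\<close>

lemma zero_extension_elementary_sse: "zero_extension \<subseteq> elementary_strong_shift_equivalence"
proof (clarsimp simp: zero_extension_def)
  fix n k and A B C :: "'a mat"
  assume A: "A \<in> carrier_mat n n"
    and "C \<in> carrier_mat n k \<and> B = four_block_mat A C (0\<^sub>m k n) (0\<^sub>m k k) \<or>
      C \<in> carrier_mat k n \<and> B = four_block_mat A (0\<^sub>m n k) C (0\<^sub>m k k)"
  then show "(A, B) \<in> elementary_strong_shift_equivalence"
  proof (elim disjE conjE)
    assume C: "C \<in> carrier_mat n k" and B: "B = four_block_mat A C (0\<^sub>m k n) (0\<^sub>m k k)"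
    have "A = (A @\<^sub>c C) * (1\<^sub>m n @\<^sub>r 0\<^sub>m k n)"
      using A C by (subst append_cols_mult_append_rows) auto
    moreover have "B = (1\<^sub>m n @\<^sub>r 0\<^sub>m k n) * (A @\<^sub>c C)"
      unfolding B using A C by (subst append_rows_mult_append_cols) auto
    ultimately show ?thesis
      using elementary_sseI[OF append_cols_carrier[OF A C]
          carrier_append_rows[OF one_carrier_mat zero_carrier_mat]] by simp
  next
    assume C: "C \<in> carrier_mat k n" and B: "B = four_block_mat A (0\<^sub>m n k) C (0\<^sub>m k k)"
    have "A = (1\<^sub>m n @\<^sub>c 0\<^sub>m n k) * (A @\<^sub>r C)"
      using A C by (subst append_cols_mult_append_rows) auto
    moreover have "B = (A @\<^sub>r C) * (1\<^sub>m n @\<^sub>c 0\<^sub>m n k)"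
      unfolding B using A C by (subst append_rows_mult_append_cols) auto
    ultimately show ?thesis
      using elementary_sseI[OF append_cols_carrier[OF one_carrier_mat zero_carrier_mat]
          carrier_append_rows[OF A C]] by simp
  qed
qed

text \<open>The shear is applied to \<open>R * S\<close> and \<open>S * R\<close>: its intertwining
  hypothesis is then associativity, and the upper left block becomes
  \<open>R * S - R * S = 0\<close>. After exchanging blocks, a zero extension of
  \<open>S * R\<close> remains.\<close>

lemma elementary_sse_generated:
  fixes R :: "'a::{ring,monoid_mult} mat"
  assumes R: "R \<in> carrier_mat m n" and S: "S \<in> carrier_mat n m"
  shows "(R * S, S * R) \<in> generated_equiv square_mats (mat_similarity \<union> zero_extension)"
    (is "_ \<in> ?G")
proof -
  have G: "equiv square_mats ?G"
    by (rule generated_equiv_is_equiv) (use relations_on_square_mats in auto)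
  have RS: "R * S \<in> carrier_mat m m" and SR: "S * R \<in> carrier_mat n n"
    using R S by auto
  let ?M = "four_block_mat (R * S) (0\<^sub>m m n) S (0\<^sub>m n n)"
  let ?N = "four_block_mat (0\<^sub>m m m) (0\<^sub>m m n) S (S * R)"
  let ?P = "four_block_mat (S * R) S (0\<^sub>m m n) (0\<^sub>m m m)"
  have "(R * S, ?M) \<in> zero_extension" "(S * R, ?P) \<in> zero_extension"
    unfolding zero_extension_def using RS SR S by blast+
  moreover have "(?M, ?N) \<in> mat_similarity"
    using mat_similarity_shear[OF RS SR R S assoc_mult_mat[OF R S R] refl] RS by simp
  moreover have "(?N, ?P) \<in> mat_similarity"
    using SR S by (intro mat_similarity_swap_blocks) auto
  ultimately have "(R * S, ?M) \<in> ?G" "(?M, ?N) \<in> ?G" "(?N, ?P) \<in> ?G" "(S * R, ?P) \<in> ?G"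
    by (simp_all add: generated_equiv_incl)
  then show ?thesis
    by (rule equiv_zigzag[OF G])
qed

theorem sse_eq_generated:
  "(strong_shift_equivalence :: 'a::{ring,monoid_mult} mat rel) =
      generated_equiv square_mats (mat_similarity \<union> zero_extension)"
proof (rule generated_equiv_eqI[OF _ equiv_sse])
  have "elementary_strong_shift_equivalence \<subseteq> (strong_shift_equivalence :: 'a mat rel)"
    unfolding strong_shift_equivalence_def by (rule subrelI) (rule r_into_trancl)
  then show "mat_similarity \<union> zero_extension \<subseteq> (strong_shift_equivalence :: 'a mat rel)"
    using Un_least[OF mat_similarity_elementary_sse zero_extension_elementary_sse]
    by (rule subset_trans[rotated])
next
  fix A B :: "'a mat"
  let ?G = "generated_equiv square_mats (mat_similarity \<union> zero_extension) :: 'a mat rel"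
  have "equiv square_mats ?G"
    by (rule generated_equiv_is_equiv) (use relations_on_square_mats in auto)
  then have tr: "trans ?G"
    unfolding equiv_def by (elim conjE)
  have le: "elementary_strong_shift_equivalence \<subseteq> ?G"
    unfolding elementary_strong_shift_equivalence_def using elementary_sse_generated by auto
  assume "(A, B) \<in> strong_shift_equivalence"
  \<comment> \<open>Since \<open>?G\<close> is its own transitive closure, containing the elementary
    pairs is enough.\<close>
  then have "(A, B) \<in> ?G\<^sup>+"
    unfolding strong_shift_equivalence_def by (rule trancl_mono[OF _ le])
  then show "(A, B) \<in> ?G"
    unfolding trancl_id[OF tr] .
qed

section \<open>Shift equivalence\<close>

lemma shift_equivalenceI:
  assumes "A \<in> carrier_mat m m" "B \<in> carrier_mat n n"
    and "R \<in> carrier_mat m n" "S \<in> carrier_mat n m" "0 < l"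
    and "mat_power A l = R * S" "mat_power B l = S * R" "A * R = R * B" "S * A = B * S"
  shows "(A, B) \<in> shift_equivalence"
  unfolding shift_equivalence_def using assms by blast

lemma equiv_se: "equiv square_mats (shift_equivalence :: 'a::{ring,monoid_mult} mat rel)"
proof (rule equivI)
  show "shift_equivalence \<subseteq> (square_mats \<times> square_mats :: 'a mat rel)"
    unfolding shift_equivalence_def square_mats_def by auto
  show "refl_on square_mats (shift_equivalence :: 'a mat rel)"
  proof (rule refl_onI)
    fix A :: "'a mat" assume "A \<in> square_mats"
    then obtain n where A: "A \<in> carrier_mat n n"
      unfolding square_mats_def by auto
    \<comment> \<open>Lag 1, with \<open>A\<close> and the identity as factors.\<close>
    show "(A, A) \<in> shift_equivalence"
      by (rule shift_equivalenceI[OF A A A one_carrier_mat zero_less_Suc[of 0]]) (use A in auto)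
  qed
  show "sym (shift_equivalence :: 'a mat rel)"
    unfolding shift_equivalence_def sym_def by clarsimp metis
  show "trans (shift_equivalence :: 'a mat rel)"
  proof (rule transI)
    fix A B C :: "'a mat"
    assume "(A, B) \<in> shift_equivalence"
    then obtain m n R S k where A: "A \<in> carrier_mat m m" and B: "B \<in> carrier_mat n n"
      and R: "R \<in> carrier_mat m n" and S: "S \<in> carrier_mat n m" and k: "0 < k"
      and Ak: "mat_power A k = R * S" and Bk: "mat_power B k = S * R"
      and AR: "A * R = R * B" and SA: "S * A = B * S"
      unfolding shift_equivalence_def by blast
    assume "(B, C) \<in> shift_equivalence"
    then obtain n' p R' S' l where "B \<in> carrier_mat n' n'" and C: "C \<in> carrier_mat p p"
      and "R' \<in> carrier_mat n' p" and "S' \<in> carrier_mat p n'" and l: "0 < l"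
      and Bl: "mat_power B l = R' * S'" and Cl: "mat_power C l = S' * R'"
      and BR: "B * R' = R' * C" and SB: "S' * B = C * S'"
      unfolding shift_equivalence_def by blast
    moreover from this(1) B have "n' = n" by auto
    ultimately have R': "R' \<in> carrier_mat n p" and S': "S' \<in> carrier_mat p n" by auto
    have RR: "R * R' \<in> carrier_mat m p" and SS: "S' * S \<in> carrier_mat p m"
      using R R' S S' by auto
    \<comment> \<open>Lags add under composition: the inner product \<open>R' * S'\<close> is the
      \<open>l\<close>-th power of \<open>B\<close>, and passing it through \<open>S\<close> turns
      it into the \<open>l\<close>-th power of \<open>A\<close>, next to
      \<open>R * S\<close>.\<close>
    have "R * R' * (S' * S) = R * (R' * (S' * S))"
      by (rule assoc_mult_mat[OF R R' SS])
    also have "R' * (S' * S) = mat_power B l * S"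
      using assoc_mult_mat[OF R' S' S] Bl by simp
    also have "\<dots> = S * mat_power A l"
      by (rule mat_power_intertwine[OF B A S SA[symmetric]])
    also have "R * \<dots> = mat_power A (k + l)"
      using assoc_mult_mat[OF R S mat_power_carrier[OF A]] mat_power_add[OF A] Ak by simp
    finally have 1: "mat_power A (k + l) = R * R' * (S' * S)" ..
    have "S' * S * (R * R') = S' * (S * (R * R'))"
      by (rule assoc_mult_mat[OF S' S RR])
    also have "S * (R * R') = mat_power B k * R'"
      using assoc_mult_mat[OF S R R'] Bk by simp
    also have "\<dots> = R' * mat_power C k"
      by (rule mat_power_intertwine[OF B C R' BR])
    also have "S' * \<dots> = mat_power C (k + l)"
      using assoc_mult_mat[OF S' R' mat_power_carrier[OF C]] mat_power_add[OF C, of l k] Cl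
      by (simp add: add.commute)
    finally have 2: "mat_power C (k + l) = S' * S * (R * R')" ..
    have 3: "A * (R * R') = R * R' * C"
      using assoc_mult_mat[OF A R R'] assoc_mult_mat[OF R B R'] assoc_mult_mat[OF R R' C] AR BR
      by simp
    have 4: "S' * S * A = C * (S' * S)"
      using assoc_mult_mat[OF S' S A] assoc_mult_mat[OF S' B S] assoc_mult_mat[OF C S' S] SA SB
      by simp
    show "(A, C) \<in> shift_equivalence"
      by (rule shift_equivalenceI[OF A C RR SS add_pos_pos[OF k l] 1 2 3 4])
  qed
qed

section \<open>Similarities and nilpotent extensions are shift equivalences\<close>

text \<open>The factors \<open>U\<close> and \<open>V * A\<close> give a shift equivalence of lag 1;
  both intertwining relations are associativity.\<close>

lemma mat_similarity_se: "mat_similarity \<subseteq> shift_equivalence"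
proof (rule subrelI)
  fix A B :: "'a mat"
  assume "(A, B) \<in> mat_similarity"
  then obtain n U V where c: "A \<in> carrier_mat n n" "U \<in> carrier_mat n n" "V \<in> carrier_mat n n"
    and UV: "U * V = 1\<^sub>m n" and B: "B = V * A * U"
    unfolding mat_similarity_def by blast
  have VA: "V * A \<in> carrier_mat n n" using c by auto
  have A: "A = U * (V * A)"
    using assoc_mult_mat[OF c(2,3,1)] UV c by simp
  have AU: "A * U = U * B"
    using assoc_mult_mat[OF c(2) VA c(2)] A B by simp
  have VAA: "V * A * A = B * (V * A)"
    using assoc_mult_mat[OF VA c(2) VA] A B by simp
  have Bn: "B \<in> carrier_mat n n"
    unfolding B using VA c by auto
  have p: "mat_power A (Suc 0) = U * (V * A)" "mat_power B (Suc 0) = V * A * U"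
    using A[symmetric] B c Bn by (simp_all del: assoc_mult_mat)
  show "(A, B) \<in> shift_equivalence"
    by (rule shift_equivalenceI[OF c(1) Bn c(2) VA zero_less_Suc[of 0] p AU VAA])
qed

text \<open>The block \<open>X\<close> stays existential because only its size and the diagonal
  blocks matter later.\<close>

lemma mat_power_upper:
  fixes A :: "'a::{ring,monoid_mult} mat"
  assumes A: "A \<in> carrier_mat n n" and N: "N \<in> carrier_mat k k" and C: "C \<in> carrier_mat n k"
  shows "\<exists>X\<in>carrier_mat n k. mat_power (four_block_mat A C (0\<^sub>m k n) N) l =
    four_block_mat (mat_power A l) X (0\<^sub>m k n) (mat_power N l)"
proof (induction l)
  case 0
  then show ?case using A N by (auto intro!: bexI[of _ "0\<^sub>m n k"])
next
  case (Suc l)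
  then obtain X where X: "X \<in> carrier_mat n k"
    and eq: "mat_power (four_block_mat A C (0\<^sub>m k n) N) l =
      four_block_mat (mat_power A l) X (0\<^sub>m k n) (mat_power N l)" by blast
  note p = mat_power_carrier[OF A, of l] mat_power_carrier[OF N, of l]
  note p = p mult_carrier_mat[OF p(1) A] mult_carrier_mat[OF p(2) N]
  have "mat_power (four_block_mat A C (0\<^sub>m k n) N) (Suc l) =
    four_block_mat (mat_power A (Suc l)) (mat_power A l * C + X * N) (0\<^sub>m k n) (mat_power N (Suc l))"
    using A N C X p by (simp add: eq mult_four_block_mat[of _ n n _ k _ k _ _ n _ k])
  moreover have "mat_power A l * C + X * N \<in> carrier_mat n k"
    using p C X N by auto
  ultimately show ?case by blast
qed

lemma mat_power_lower:
  fixes A :: "'a::{ring,monoid_mult} mat"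
  assumes A: "A \<in> carrier_mat n n" and N: "N \<in> carrier_mat k k" and C: "C \<in> carrier_mat k n"
  shows "\<exists>X\<in>carrier_mat k n. mat_power (four_block_mat A (0\<^sub>m n k) C N) l =
    four_block_mat (mat_power A l) (0\<^sub>m n k) X (mat_power N l)"
proof (induction l)
  case 0
  then show ?case using A N by (auto intro!: bexI[of _ "0\<^sub>m k n"])
next
  case (Suc l)
  then obtain X where X: "X \<in> carrier_mat k n"
    and eq: "mat_power (four_block_mat A (0\<^sub>m n k) C N) l =
      four_block_mat (mat_power A l) (0\<^sub>m n k) X (mat_power N l)" by blast
  note p = mat_power_carrier[OF A, of l] mat_power_carrier[OF N, of l]
  note p = p mult_carrier_mat[OF p(1) A] mult_carrier_mat[OF p(2) N]
  have "mat_power (four_block_mat A (0\<^sub>m n k) C N) (Suc l) =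
    four_block_mat (mat_power A (Suc l)) (0\<^sub>m n k) (X * A + mat_power N l * C) (mat_power N (Suc l))"
    using A N C X p by (simp add: eq mult_four_block_mat[of _ n n _ k _ k _ _ n _ k])
  moreover have "X * A + mat_power N l * C \<in> carrier_mat k n"
    using p C X A by auto
  ultimately show ?case by blast
qed

text \<open>The lag is an exponent that kills \<open>N\<close>. The corresponding power of
  \<open>B\<close> has a zero block row (or column), so it factors through the inclusion
  \<open>I\<close> (or the projection \<open>J\<close>), which intertwines \<open>A\<close> and
  \<open>B\<close>.\<close>

lemma nilpotent_extension_se: "nilpotent_extension \<subseteq> shift_equivalence"
proof (clarsimp simp: nilpotent_extension_def)
  fix n k and A B C N :: "'a mat"
  assume A: "A \<in> carrier_mat n n" and N: "N \<in> carrier_mat k k" and "nilpotent_mat N"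
    and cases: "C \<in> carrier_mat n k \<and> B = four_block_mat A C (0\<^sub>m k n) N \<or>
      C \<in> carrier_mat k n \<and> B = four_block_mat A (0\<^sub>m n k) C N"
  then obtain l' where "mat_power N l' = 0\<^sub>m k k"
    unfolding nilpotent_mat_def by auto
  \<comment> \<open>The given exponent may be 0, for instance when \<open>N\<close> is empty, but a
    lag must be positive.\<close>
  then have Nl: "mat_power N (Suc l') = 0\<^sub>m k k"
    using N by simp
  define l where "l = Suc l'"
  have l: "0 < l" and Nl: "mat_power N l = 0\<^sub>m k k"
    unfolding l_def using Nl by auto
  have Al: "mat_power A l \<in> carrier_mat n n"
    using A by simp
  have B: "B \<in> carrier_mat (n + k) (n + k)"
    using cases A N by auto
  have BB: "B * mat_power B l = mat_power B l * B"
    using mat_power_Suc_left[OF B, of l] by simp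
  define I :: "'a mat" where "I = 1\<^sub>m n @\<^sub>r 0\<^sub>m k n"
  define J :: "'a mat" where "J = 1\<^sub>m n @\<^sub>c 0\<^sub>m n k"
  have I: "I \<in> carrier_mat (n + k) n" and J: "J \<in> carrier_mat n (n + k)"
    unfolding I_def J_def by auto
  have JI: "J * I = 1\<^sub>m n"
    unfolding I_def J_def by (subst append_cols_mult_append_rows) auto
  show "(A, B) \<in> shift_equivalence"
    using cases
  proof (elim disjE conjE)
    assume C: "C \<in> carrier_mat n k" and B_eq: "B = four_block_mat A C (0\<^sub>m k n) N"
    obtain X where X: "X \<in> carrier_mat n k"
      and Bl: "mat_power B l = four_block_mat (mat_power A l) X (0\<^sub>m k n) (0\<^sub>m k k)"
      using mat_power_upper[OF A N C, of l] Nl unfolding B_eq by auto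
    define R where "R = mat_power A l @\<^sub>c X"
    have R: "R \<in> carrier_mat n (n + k)"
      unfolding R_def using Al X by auto
    have RI: "mat_power A l = R * I"
      unfolding R_def I_def using Al X by (subst append_cols_mult_append_rows) auto
    have IR: "mat_power B l = I * R"
      unfolding R_def I_def Bl using Al X by (subst append_rows_mult_append_cols) auto
    have IA: "I * A = B * I"
      unfolding I_def B_eq using A C N
      by (simp add: append_rows_mult[of _ n n _ k _ n] four_block_mult_append_rows[of _ n n _ k _ k _ _ n])
    \<comment> \<open>As \<open>X\<close> is unknown, \<open>A * R = R * B\<close> is not checked
      blockwise. Both sides agree after multiplication by \<open>I\<close>, since \<open>B\<close>
      commutes with its power \<open>I * R\<close>, and \<open>I\<close> has the left inverse
      \<open>J\<close>.\<close>
    have "I * (A * R) = B * (I * R)"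
      using assoc_mult_mat[OF I A R] assoc_mult_mat[OF B I R] IA by simp
    also have "\<dots> = I * (R * B)"
      using BB assoc_mult_mat[OF I R B] IR by simp
    finally have "J * (I * (A * R)) = J * (I * (R * B))" by simp
    moreover have "J * (I * Y) = Y" if "Y \<in> carrier_mat n (n + k)" for Y
      using assoc_mult_mat[OF J I that] JI that by simp
    ultimately have "A * R = R * B"
      using A R B by (metis mult_carrier_mat)
    then show ?thesis
      by (rule shift_equivalenceI[OF A B R I l RI IR _ IA])
  next
    assume C: "C \<in> carrier_mat k n" and B_eq: "B = four_block_mat A (0\<^sub>m n k) C N"
    obtain X where X: "X \<in> carrier_mat k n"
      and Bl: "mat_power B l = four_block_mat (mat_power A l) (0\<^sub>m n k) X (0\<^sub>m k k)"
      using mat_power_lower[OF A N C, of l] Nl unfolding B_eq by auto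
    define S where "S = mat_power A l @\<^sub>r X"
    have S: "S \<in> carrier_mat (n + k) n"
      unfolding S_def using Al X by auto
    have JS: "mat_power A l = J * S"
      unfolding S_def J_def using Al X by (subst append_cols_mult_append_rows) auto
    have SJ: "mat_power B l = S * J"
      unfolding S_def J_def Bl using Al X by (subst append_rows_mult_append_cols) auto
    have AJ: "A * J = J * B"
      unfolding J_def B_eq using A C N
      by (simp add: mult_append_cols[of _ n n _ n _ k] append_cols_mult_four_block[of _ n n _ k _ n _ k])
    \<comment> \<open>The dual argument: \<open>J\<close> is cancelled on the right by means of
      \<open>I\<close>.\<close>
    have "S * A * J = S * J * B"
      using assoc_mult_mat[OF S A J] assoc_mult_mat[OF S J B] AJ by simp
    also have "\<dots> = B * S * J"
      using BB assoc_mult_mat[OF B S J] SJ by simp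
    finally have "S * A * J * I = B * S * J * I" by simp
    moreover have "Y * J * I = Y" if "Y \<in> carrier_mat (n + k) n" for Y
      using assoc_mult_mat[OF that J I] JI that by simp
    ultimately have "S * A = B * S"
      using A S B by (metis mult_carrier_mat)
    then show ?thesis
      by (rule shift_equivalenceI[OF A B J S l JS SJ AJ])
  qed
qed

section \<open>Lowering the lag by zero extensions\<close>

text \<open>Each multiplication by the extension only multiplies the left block column by
  \<open>A\<close>. The lower left block starts with \<open>S\<close> at exponent 1 and so stays one
  power of \<open>A\<close> behind the corner.\<close>

lemma mat_power_zero_extension:
  fixes A :: "'a::{ring,monoid_mult} mat"
  assumes A: "A \<in> carrier_mat n n" and S: "S \<in> carrier_mat k n"
  shows "mat_power (four_block_mat A (0\<^sub>m n k) S (0\<^sub>m k k)) (Suc j) =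
    four_block_mat (mat_power A (Suc j)) (0\<^sub>m n k) (S * mat_power A j) (0\<^sub>m k k)"
proof (induction j)
  case (Suc j)
  have mult: "four_block_mat P (0\<^sub>m n k) Q (0\<^sub>m k k) * four_block_mat A (0\<^sub>m n k) S (0\<^sub>m k k) =
      four_block_mat (P * A) (0\<^sub>m n k) (Q * A) (0\<^sub>m k k)"
    if P: "P \<in> carrier_mat n n" and Q: "Q \<in> carrier_mat k n" for P Q
    using mult_four_block_mat[OF P zero_carrier_mat Q zero_carrier_mat A zero_carrier_mat S zero_carrier_mat]
      P Q A S mult_carrier_mat[OF P A] mult_carrier_mat[OF Q A]
    by simp
  note p = mat_power_carrier[OF A, of j]
  have "S * mat_power A j * A = S * mat_power A (Suc j)"
    using assoc_mult_mat[OF S p A] by simp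
  then show ?case
    unfolding mat_power.simps(2)[of _ "Suc j"] Suc
    by (subst mult[OF mat_power_carrier[OF A] mult_carrier_mat[OF S p]]) simp
qed (use A S in auto)

lemma nilpotent_minus:
  fixes A :: "'a::{ring,monoid_mult} mat"
  assumes A: "A \<in> carrier_mat m m" and B: "B \<in> carrier_mat n n"
    and R: "R \<in> carrier_mat m n" and S: "S \<in> carrier_mat n m" and K: "K \<in> carrier_mat n m"
    and AR: "A * R = R * B" and SR: "S * R = B" and Ak: "mat_power A k = R * K"
  shows "nilpotent_mat (A - R * S)"
proof -
  define N where "N = A - R * S"
  have RS: "R * S \<in> carrier_mat m m" using R S by auto
  have N: "N \<in> carrier_mat m m" unfolding N_def by (rule minus_carrier_mat[OF RS])
  have NR: "N * R = 0\<^sub>m m n"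
    unfolding N_def
    using minus_mult_distrib_mat[OF A RS R] assoc_mult_mat[OF R S R] AR SR R B by simp
  have "N * (R * S) = 0\<^sub>m m m"
    using assoc_mult_mat[OF N R S] NR S by simp
  moreover have "N * N = N * A - N * (R * S)"
    using mult_minus_distrib_mat[OF N A RS] by (simp add: N_def)
  ultimately have NN: "N * N = N * A"
    using N A by auto
  \<comment> \<open>From \<open>N * N = N * A\<close>, every factor \<open>N\<close> except the
    leftmost can be replaced by \<open>A\<close>.\<close>
  have "mat_power N (Suc j) = N * mat_power A j" for j
  proof (induction j)
    case (Suc j)
    have "mat_power N (Suc (Suc j)) = N * (N * mat_power A j)"
      using mat_power_Suc_left[OF N, of "Suc j"] Suc by simp
    also have "\<dots> = N * (A * mat_power A j)"
      using assoc_mult_mat[OF N N mat_power_carrier[OF A]]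
        assoc_mult_mat[OF N A mat_power_carrier[OF A]] NN by simp
    finally show ?case
      using mat_power_Suc_left[OF A] by simp
  qed (use N A in auto)
  \<comment> \<open>This power is \<open>N * (R * K)\<close>, which vanishes by
    \<open>NR\<close>.\<close>
  then have "mat_power N (Suc k) = 0\<^sub>m m m"
    using assoc_mult_mat[OF N R K] NR Ak K by simp
  then show ?thesis
    using N unfolding nilpotent_mat_def N_def[symmetric] by (auto intro: exI[of _ "Suc k"])
qed

text \<open>Unlike the condition \<open>S * A = B * S\<close> of shift equivalence, these hypotheses survive the
  replacement of \<open>A\<close> by its zero extension with row \<open>(S, 0)\<close>, which lowers \<open>l\<close>.\<close>

lemma lag_generated:
  fixes A :: "'a::{ring,monoid_mult} mat"
  assumes "A \<in> carrier_mat m m" and "B \<in> carrier_mat n n"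
    and "R \<in> carrier_mat m n" and "S \<in> carrier_mat n m" and "K \<in> carrier_mat n m"
    and "A * R = R * B" and "S * R = mat_power B (Suc l)"
    and "mat_power A k = R * K" and "K * A = B * K"
  shows "(A, B) \<in> generated_equiv square_mats (mat_similarity \<union> nilpotent_extension)"
    (is "_ \<in> ?G")
  using assms
\<comment> \<open>\<open>B\<close> stays fixed, while each step passes to a zero extension of
  \<open>A\<close> with new \<open>R\<close>, \<open>S\<close>, \<open>K\<close> and
  \<open>k\<close>.\<close>
proof (induction l arbitrary: m A R S K k)
  case 0
  note A = 0(1) and B = 0(2) and R = 0(3) and S = 0(4) and K = 0(5) and AR = 0(6)
  have G: "equiv square_mats ?G"
    by (rule generated_equiv_is_equiv) (use relations_on_square_mats in auto)
  have SR: "S * R = B" using 0(7) B by simp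
  have N: "A - R * S \<in> carrier_mat m m"
    by (rule minus_carrier_mat[OF mult_carrier_mat[OF R S]])
  let ?M = "four_block_mat A (0\<^sub>m m n) S (0\<^sub>m n n)"
  let ?N = "four_block_mat (A - R * S) (0\<^sub>m m n) S B"
  \<comment> \<open>The shear has put \<open>B\<close> in the lower right corner; with the blocks
    exchanged, \<open>?P\<close> is a nilpotent extension of \<open>B\<close> with corner
    \<open>A - R * S\<close>.\<close>
  let ?P = "four_block_mat B S (0\<^sub>m m n) (A - R * S)"
  have "(A, ?M) \<in> zero_extension"
    unfolding zero_extension_def using A S by blast
  moreover have "(?M, ?N) \<in> mat_similarity"
    by (rule mat_similarity_shear[OF A B R S AR SR])
  moreover have "(?N, ?P) \<in> mat_similarity"
    using N B S by (intro mat_similarity_swap_blocks) auto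
  moreover have "(B, ?P) \<in> nilpotent_extension"
    unfolding nilpotent_extension_def
    using nilpotent_minus[OF A B R S K AR SR 0(8)] N B S by blast
  ultimately have "(A, ?M) \<in> ?G" "(?M, ?N) \<in> ?G" "(?N, ?P) \<in> ?G" "(B, ?P) \<in> ?G"
    using zero_extension_nilpotent by (auto intro: generated_equiv_incl)
  then show ?case
    by (rule equiv_zigzag[OF G])
next
  case (Suc l)
  note A = Suc(2) and B = Suc(3) and R = Suc(4) and S = Suc(5) and K = Suc(6)
    and AR = Suc(7) and SR = Suc(8) and Ak = Suc(9) and KA = Suc(10)
  have G: "equiv square_mats ?G"
    by (rule generated_equiv_is_equiv) (use relations_on_square_mats in auto)
  define P where "P = mat_power B (Suc l)"
  have P: "P \<in> carrier_mat n n"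
    unfolding P_def by (rule mat_power_carrier[OF B])
  have BK: "B * K \<in> carrier_mat n m" using B K by auto
  let ?A = "four_block_mat A (0\<^sub>m m n) S (0\<^sub>m n n)"
  \<comment> \<open>The lower block \<open>P\<close> is forced by \<open>S * R = P * B\<close>,
    which makes \<open>?R\<close> intertwine \<open>?A\<close> and \<open>B\<close>. Then
    \<open>?S\<close> picks out \<open>P\<close>, a power of \<open>B\<close> with exponent one less
    than in \<open>S * R\<close>.\<close>
  let ?R = "R @\<^sub>r P"
  let ?S = "0\<^sub>m n m @\<^sub>c 1\<^sub>m n"
  \<comment> \<open>In the next power of \<open>?A\<close>, the left blocks are
    \<open>R * K * A = R * (B * K)\<close> and \<open>S * R * K = P * (B * K)\<close>; the common
    right factor \<open>B * K\<close> gives \<open>?K\<close>.\<close>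
  let ?K = "(B * K) @\<^sub>c 0\<^sub>m n n"
  have PB: "S * R = P * B" using SR unfolding P_def by simp
  have AR': "?A * ?R = ?R * B"
  proof -
    have "?A * ?R = (A * R) @\<^sub>r (S * R)"
      using A R S P B by (subst four_block_mult_append_rows) auto
    also have "\<dots> = ?R * B"
      using append_rows_mult[OF R P B] AR PB by simp
    finally show ?thesis .
  qed
  have SR': "?S * ?R = mat_power B (Suc l)"
    unfolding P_def[symmetric]
    using R P by (subst append_cols_mult_append_rows) auto
  have SAk: "S * mat_power A k = P * (B * K)"
    using assoc_mult_mat[OF S R K] assoc_mult_mat[OF P B K] Ak PB by simp
  have "mat_power A (Suc k) = R * (B * K)"
    using assoc_mult_mat[OF R K A] Ak KA by simp
  then have Ak': "mat_power ?A (Suc k) = ?R * ?K"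
    unfolding mat_power_zero_extension[OF A S] SAk
    using R P BK by (subst append_rows_mult_append_cols) auto
  have KA': "?K * ?A = B * ?K"
  proof -
    have "?K * ?A = (B * K * A) @\<^sub>c 0\<^sub>m n n"
      using A S BK B K by (subst append_cols_mult_four_block) auto
    also have "B * K * A = B * (B * K)"
      using assoc_mult_mat[OF B K A] KA by simp
    also have "(B * (B * K)) @\<^sub>c 0\<^sub>m n n = B * ?K"
      using mult_append_cols[OF B BK zero_carrier_mat] B by simp
    finally show ?thesis .
  qed
  have "(?A, B) \<in> ?G"
    by (rule Suc.IH[OF _ B _ _ _ AR' SR' Ak' KA']) (use A S R P BK in auto)
  moreover have "(A, ?A) \<in> ?G"
  proof -
    have "(A, ?A) \<in> zero_extension"
      unfolding zero_extension_def using A S by blast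
    then show ?thesis
      using zero_extension_nilpotent by (auto intro: generated_equiv_incl)
  qed
  ultimately show ?case
    using G unfolding equiv_def by (blast dest: transD)
qed

theorem se_eq_generated:
  "(shift_equivalence :: 'a::{ring,monoid_mult} mat rel) =
      generated_equiv square_mats (mat_similarity \<union> nilpotent_extension)"
proof (rule generated_equiv_eqI[OF _ equiv_se])
  show "mat_similarity \<union> nilpotent_extension \<subseteq> (shift_equivalence :: 'a mat rel)"
    using mat_similarity_se nilpotent_extension_se by blast
next
  fix A B :: "'a mat"
  assume "(A, B) \<in> shift_equivalence"
  then obtain m n R S l where c: "A \<in> carrier_mat m m" "B \<in> carrier_mat n n"
    "R \<in> carrier_mat m n" "S \<in> carrier_mat n m" and "0 < l"
    and Al: "mat_power A l = R * S" and Bl: "mat_power B l = S * R"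
    and AR: "A * R = R * B" and SA: "S * A = B * S"
    unfolding shift_equivalence_def by blast
  from \<open>0 < l\<close> obtain l' where "l = Suc l'"
    by (cases l) auto
  with Bl have "S * R = mat_power B (Suc l')"
    by simp
  \<comment> \<open>Initially \<open>S\<close> also plays the role of \<open>K\<close>, with
    \<open>k = l\<close>; the two diverge during the induction.\<close>
  then show "(A, B) \<in> generated_equiv square_mats (mat_similarity \<union> nilpotent_extension)"
    by (rule lag_generated[OF c c(4) AR _ Al SA])
qed

theorem theorem6p5p1:
  shows "
    (strong_shift_equivalence :: 'a::{ring,monoid_mult} mat rel) =
      generated_equiv square_mats (mat_similarity \<union> zero_extension) \<and>
    (shift_equivalence :: 'a::{ring,monoid_mult} mat rel) =
      generated_equiv square_mats (mat_similarity \<union> nilpotent_extension)"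
  by (rule conjI[OF sse_eq_generated se_eq_generated])

end
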